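(* Let $\Phi$ be a family of probability distributions which is dense in the space of all probability distributions on $\mathbb{R}^d$ with respect to weak convergence, for every $d\in\mathbb{N}$. Let $T>0$. Then the class of $\Phi$ processes with stepwise paths with steps of equal length is dense in the space of processes with paths in $D([0,T])$ endowed with the Skorokhod topology, with respect to weak convergence.
   Context: $D([0,T])$ is the space of real functions on $[0,T]$ that are right-continuous and have left-hand limits, endowed with the Skorokhod ($J_1$) topology, induced by the metric $d_T(x,y)=\inf_{\lambda\in\Lambda_T}\{\sup_{t\in[0,T]}|\lambda t-t|\vee\sup_{t\in[0,T]}|x(t)-y(\lambda t)|\}$, where $\Lambda_T$ is the class of strictly increasing continuous maps of $[0,T]$ onto itself. A $\Phi$ process is a stochastic process whose finite dimensional distributions belong to $\Phi$, i.e. for all $k\in\mathbb{N}$ and all times $t_1,\dots,t_k$ in the index set, the law of the values of the process at $t_1,\dots,t_k$ belongs to $\Phi$. A process on $[0,T]$ has stepwise paths with steps of equal length if there is $N\in\mathbb{N}$ such that its paths are constant on each interval $[kT/N,(k+1)T/N)$, $k=0,\dots,N-1$. Weak convergence of processes (convergence in distribution) means weak convergence of their laws on $D([0,T])$ with the Skorokhod topology.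
   Formalization: Added hypothesis: Φ is stable under selecting coordinates, repetitions allowed. Without it the claim fails: if Φ consists of the laws without ties between coordinates, Φ is dense for every d, but no process with stepwise paths is a Φ process. *)

theory Defs
  imports "HOL-Probability.Probability"
begin

section \<open>Weak convergence of probability measures on a topological space\<close>

definition borel_of :: "'a topology \<Rightarrow> 'a measure" where
  "borel_of X = sigma (topspace X) {U. openin X U}"

definition prob_measures :: "'a topology \<Rightarrow> 'a measure set" where
  "prob_measures X = {\<mu>. prob_space \<mu> \<and> sets \<mu> = sets (borel_of X)}"

definition bounded_continuous :: "'a topology \<Rightarrow> ('a \<Rightarrow> real) set" where
  "bounded_continuous X = {f. continuous_map X euclideanreal f \<and> bounded (f ` topspace X)}"

text \<open>The coarsest topology on the Borel probability measures making \<open>\<mu> \<mapsto> \<integral> f d\<mu>\<close> continuous for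
  every bounded continuous \<open>f\<close>; lemma \<open>limitin_weak_topology\<close> identifies its convergence.\<close>

definition weak_topology :: "'a topology \<Rightarrow> 'a measure topology" where
  "weak_topology X = topology_generated_by
     {{\<mu> \<in> prob_measures X. (\<integral>x. f x \<partial>\<mu>) \<in> U} | f U. f \<in> bounded_continuous X \<and> open U}"

lemma topspace_weak_topology: "topspace (weak_topology X) = prob_measures X"
proof -
  have "(\<lambda>x. 0) \<in> bounded_continuous X"
    by (auto simp: bounded_continuous_def bounded_iff)
  then show ?thesis
    unfolding weak_topology_def topology_generated_by_topspace
    by (auto intro!: exI[of _ "prob_measures X"] exI[of _ "\<lambda>x. 0"] exI[of _ UNIV])
qed

lemma limitin_weak_topology:
  "limitin (weak_topology X) \<nu> \<mu> F \<longleftrightarrow>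
     \<mu> \<in> prob_measures X \<and> (\<forall>\<^sub>F n in F. \<nu> n \<in> prob_measures X) \<and>
     (\<forall>f\<in>bounded_continuous X. ((\<lambda>n. \<integral>x. f x \<partial>\<nu> n) \<longlongrightarrow> (\<integral>x. f x \<partial>\<mu>)) F)"
  (is "?L \<longleftrightarrow> ?R")
proof
  assume L: ?L
  have mu: "\<mu> \<in> prob_measures X"
    using L by (auto simp: limitin_def topspace_weak_topology)
  have ev: "\<forall>\<^sub>F n in F. \<nu> n \<in> prob_measures X"
    using L mu openin_topspace[of "weak_topology X"] unfolding limitin_def topspace_weak_topology by blast
  have "((\<lambda>n. \<integral>x. f x \<partial>\<nu> n) \<longlongrightarrow> (\<integral>x. f x \<partial>\<mu>)) F" if f: "f \<in> bounded_continuous X" for f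
  proof (rule topological_tendstoI)
    fix U :: "real set" assume U: "open U" "(\<integral>x. f x \<partial>\<mu>) \<in> U"
    let ?S = "{\<mu> \<in> prob_measures X. (\<integral>x. f x \<partial>\<mu>) \<in> U}"
    have "openin (weak_topology X) ?S"
      unfolding weak_topology_def by (rule topology_generated_by_Basis) (use f U in blast)
    then have "\<forall>\<^sub>F n in F. \<nu> n \<in> ?S"
      using L U mu unfolding limitin_def by blast
    then show "\<forall>\<^sub>F n in F. (\<integral>x. f x \<partial>\<nu> n) \<in> U"
      by (rule eventually_mono) simp
  qed
  with mu ev show ?R by blast
next
  assume R: ?R
  let ?B = "{{\<mu> \<in> prob_measures X. (\<integral>x. f x \<partial>\<mu>) \<in> U} | f U. f \<in> bounded_continuous X \<and> open U}"
  have "\<mu> \<in> S \<longrightarrow> (\<forall>\<^sub>F n in F. \<nu> n \<in> S)" if "generate_topology_on ?B S" for S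
    using that
  proof induction
    case (Basis s)
    then obtain f U where s: "s = {\<mu> \<in> prob_measures X. (\<integral>x. f x \<partial>\<mu>) \<in> U}"
      and f: "f \<in> bounded_continuous X" and U: "open U" by blast
    show ?case
    proof
      assume "\<mu> \<in> s"
      then have "\<forall>\<^sub>F n in F. (\<integral>x. f x \<partial>\<nu> n) \<in> U"
        using R f U s topological_tendstoD by blast
      moreover have "\<forall>\<^sub>F n in F. \<nu> n \<in> prob_measures X"
        using R by blast
      ultimately show "\<forall>\<^sub>F n in F. \<nu> n \<in> s"
        by eventually_elim (simp add: s)
    qed
  next
    case (UN K)
    show ?case
    proof
      assume "\<mu> \<in> \<Union>K"
      then obtain k where k: "k \<in> K" "\<mu> \<in> k" by blast
      then have "\<forall>\<^sub>F n in F. \<nu> n \<in> k" using UN by blast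
      then show "\<forall>\<^sub>F n in F. \<nu> n \<in> \<Union>K"
        by (rule eventually_mono) (use k in blast)
    qed
  qed (auto simp: eventually_conj_iff)
  moreover have "\<mu> \<in> topspace (weak_topology X)"
    using R by (simp add: topspace_weak_topology)
  ultimately show ?L
    unfolding limitin_def weak_topology_def openin_topology_generated_by_iff by blast
qed

section \<open>The Skorokhod space\<close>

text \<open>Paths on \<open>[0,T]\<close> are represented by functions that are \<open>undefined\<close> outside \<open>[0,T]\<close>.\<close>

definition cadlag_paths :: "real \<Rightarrow> (real \<Rightarrow> real) set" where
  "cadlag_paths T = {x \<in> extensional {0..T}.
     (\<forall>t\<in>{0..<T}. (x \<longlongrightarrow> x t) (at_right t)) \<and> (\<forall>t\<in>{0<..T}. \<exists>l. (x \<longlongrightarrow> l) (at_left t))}"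

definition time_changes :: "real \<Rightarrow> (real \<Rightarrow> real) set" where
  "time_changes T = {\<theta>. strict_mono_on {0..T} \<theta> \<and> continuous_on {0..T} \<theta> \<and> \<theta> ` {0..T} = {0..T}}"

definition skorokhod_dist :: "real \<Rightarrow> (real \<Rightarrow> real) \<Rightarrow> (real \<Rightarrow> real) \<Rightarrow> real" where
  "skorokhod_dist T x y =
     (INF \<theta>\<in>time_changes T. max (SUP t\<in>{0..T}. \<bar>\<theta> t - t\<bar>) (SUP t\<in>{0..T}. \<bar>x t - y (\<theta> t)\<bar>))"

definition skorokhod :: "real \<Rightarrow> (real \<Rightarrow> real) topology" where
  "skorokhod T = Metric_space.mtopology (cadlag_paths T) (skorokhod_dist T)"

section \<open>Processes\<close>

definition path :: "real \<Rightarrow> (real \<Rightarrow> 'w \<Rightarrow> real) \<Rightarrow> 'w \<Rightarrow> real \<Rightarrow> real" where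
  "path T X \<omega> = (\<lambda>t\<in>{0..T}. X t \<omega>)"

definition cadlag_process :: "real \<Rightarrow> 'w measure \<Rightarrow> (real \<Rightarrow> 'w \<Rightarrow> real) \<Rightarrow> bool" where
  "cadlag_process T M X \<longleftrightarrow> prob_space M \<and> (\<forall>t\<in>{0..T}. X t \<in> borel_measurable M) \<and>
     path T X \<in> M \<rightarrow>\<^sub>M borel_of (skorokhod T)"

definition process_law :: "real \<Rightarrow> 'w measure \<Rightarrow> (real \<Rightarrow> 'w \<Rightarrow> real) \<Rightarrow> (real \<Rightarrow> real) measure" where
  "process_law T M X = distr M (borel_of (skorokhod T)) (path T X)"

text \<open>\<open>Euclidean_space k\<close> consists of the real sequences vanishing from index \<open>k\<close> on.\<close>

definition fin_dim_law ::
  "'w measure \<Rightarrow> (real \<Rightarrow> 'w \<Rightarrow> real) \<Rightarrow> nat \<Rightarrow> (nat \<Rightarrow> real) \<Rightarrow> (nat \<Rightarrow> real) measure" where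
  "fin_dim_law M X k t =
     distr M (borel_of (Euclidean_space k)) (\<lambda>\<omega> i. if i < k then X (t i) \<omega> else 0)"

text \<open>\<open>\<Phi> k\<close> is the set of the members of the family \<open>\<Phi>\<close> that are distributions on \<open>\<real>\<^sup>k\<close>.\<close>

definition is_Phi_process ::
  "(nat \<Rightarrow> (nat \<Rightarrow> real) measure set) \<Rightarrow> real \<Rightarrow> 'w measure \<Rightarrow> (real \<Rightarrow> 'w \<Rightarrow> real) \<Rightarrow> bool" where
  "is_Phi_process \<Phi> T M X \<longleftrightarrow>
     (\<forall>k\<ge>1. \<forall>t. (\<forall>i<k. t i \<in> {0..T}) \<longrightarrow> fin_dim_law M X k t \<in> \<Phi> k)"

text \<open>The value at the endpoint \<open>T\<close> is not constrained.\<close>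

definition equal_step_paths :: "real \<Rightarrow> 'w measure \<Rightarrow> (real \<Rightarrow> 'w \<Rightarrow> real) \<Rightarrow> bool" where
  "equal_step_paths T M X \<longleftrightarrow>
     (\<exists>N\<ge>1. \<forall>\<omega>\<in>space M. \<forall>k<N.
        (\<lambda>t. X t \<omega>) constant_on {real k * T / real N ..< (real k + 1) * T / real N})"

text \<open>Stability under the maps \<open>(x\<^sub>1,\<dots>,x\<^sub>m) \<mapsto> (x\<^bsub>\<sigma> 1\<^esub>,\<dots>,x\<^bsub>\<sigma> k\<^esub>)\<close>, repetitions allowed. A stepwise
  process takes equal values at distinct times of one step, so its finite-dimensional
  distributions are the images under these maps of the joint law of its step values. Density
  alone does not suffice: if \<open>\<Phi> k\<close> consists of the laws without ties between coordinates, it is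
  dense for every \<open>k\<close>, but no stepwise process is a \<open>\<Phi>\<close> process.\<close>

definition coordinate_stable :: "(nat \<Rightarrow> (nat \<Rightarrow> real) measure set) \<Rightarrow> bool" where
  "coordinate_stable \<Phi> \<longleftrightarrow>
     (\<forall>m\<ge>1. \<forall>k\<ge>1. \<forall>\<sigma>. (\<forall>i<k. \<sigma> i < m) \<longrightarrow>
        (\<forall>\<mu>\<in>\<Phi> m. distr \<mu> (borel_of (Euclidean_space k)) (\<lambda>x i. if i < k then x (\<sigma> i) else 0) \<in> \<Phi> k))"

end

theory Submission
  imports Defs
begin

text \<open>
  Freezing a cadlag path \<open>x\<close> on the \<open>N\<close> equal steps at its left grid values gives a step path
  \<open>\<pi>\<^sub>N x\<close>, and \<open>\<pi>\<^sub>N x\<close> converges to \<open>x\<close> in the Skorokhod topology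
  (\<open>limitin_step_path_grid_values\<close>). By dominated convergence every law \<open>\<mu>\<close> on the Skorokhod
  space is therefore the weak limit of its images under \<open>\<pi>\<^sub>N\<close>.

  The map \<open>\<pi>\<^sub>N\<close> factors through a Euclidean space: it reads off the \<open>N + 1\<close> values at the grid
  points and then builds a step path from them. The second map is continuous, so pushing laws
  forward along it is continuous for the weak topologies
  (\<open>continuous_map_weak_topology_distr\<close>). Since \<open>\<Phi> (N + 1)\<close> is dense, the image of \<open>\<mu>\<close>
  under \<open>\<pi>\<^sub>N\<close> lies in the closure of the laws of step paths whose vector of values has a law in
  \<open>\<Phi> (N + 1)\<close>. The process with such a law is a \<open>\<Phi>\<close> process, because its values at any times
  are step values, possibly repeated, and \<open>\<Phi>\<close> is stable under selecting coordinates
  (\<open>step_process\<close>). So \<open>\<mu>\<close> is a limit of points of a closed set, the closure in question.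

  Two facts about the Skorokhod space support this. It is a metric space, and its coordinates are
  Borel measurable, which makes the reading of the grid values measurable
  (\<open>coordinate_borel_measurable\<close>).
\<close>

section \<open>Borel sets of topological spaces\<close>

lemma space_borel_of: "space (borel_of X) = topspace X"
  by (simp add: borel_of_def space_measure_of_conv)

lemma sets_borel_of: "sets (borel_of X) = sigma_sets (topspace X) {U. openin X U}"
  unfolding borel_of_def by (rule sets_measure_of) (auto dest: openin_subset)

lemma openin_in_sets_borel_of: "openin X U \<Longrightarrow> U \<in> sets (borel_of X)"
  by (simp add: sets_borel_of)

lemma continuous_map_measurable_borel_of:
  assumes "continuous_map X Y f"
  shows "f \<in> borel_of X \<rightarrow>\<^sub>M borel_of Y"
proof (rule measurable_sigma_sets[OF sets_borel_of])
  show "f \<in> space (borel_of X) \<rightarrow> topspace Y"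
    using assms by (auto simp: space_borel_of continuous_map_def)
  fix U assume "U \<in> {U. openin Y U}"
  then have "openin X {x \<in> topspace X. f x \<in> U}"
    using assms by (simp add: continuous_map_def)
  moreover have "f -` U \<inter> space (borel_of X) = {x \<in> topspace X. f x \<in> U}"
    by (auto simp: space_borel_of)
  ultimately show "f -` U \<inter> space (borel_of X) \<in> sets (borel_of X)"
    by (simp add: openin_in_sets_borel_of)
qed (auto dest: openin_subset)

lemma continuous_map_real_borel_measurable:
  assumes "continuous_map X euclideanreal f"
  shows "f \<in> borel_measurable (borel_of X)"
proof -
  have "sets (borel_of euclideanreal) = sets borel"
    by (simp add: sets_borel_of borel_def)
  with continuous_map_measurable_borel_of[OF assms] show ?thesis
    by (simp cong: measurable_cong_sets)
qed

lemma openin_Euclidean_space: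
  "openin (Euclidean_space n) U \<longleftrightarrow> (\<exists>V. open V \<and> U = V \<inter> topspace (Euclidean_space n))"
  by (simp add: Euclidean_space_def euclidean_product_topology openin_subtopology)

text \<open>A Euclidean space is a subspace of a countable power of the reals, and by second countability
  the Borel sets of such a power are generated by the coordinates.\<close>

lemma measurable_Euclidean_spaceI:
  assumes "\<And>i. i < k \<Longrightarrow> (\<lambda>w. f w i) \<in> borel_measurable M"
    and zero: "\<And>w i. i \<ge> k \<Longrightarrow> f w i = 0"
  shows "f \<in> M \<rightarrow>\<^sub>M borel_of (Euclidean_space k)"
proof (rule measurable_sigma_sets[OF sets_borel_of])
  show "f \<in> space M \<rightarrow> topspace (Euclidean_space k)"
    by (auto simp: topspace_Euclidean_space zero)
  have "(\<lambda>w. f w i) \<in> borel_measurable M" for i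
    using assms by (cases "i < k") auto
  then have f: "f \<in> borel_measurable M"
    by (rule measurable_coordinatewise_then_product)
  fix U assume "U \<in> {U. openin (Euclidean_space k) U}"
  then obtain V where V: "open V" "U = V \<inter> topspace (Euclidean_space k)"
    by (auto simp: openin_Euclidean_space)
  have "f -` U \<inter> space M = f -` V \<inter> space M"
    by (auto simp: V topspace_Euclidean_space zero)
  also have "\<dots> \<in> sets M"
    using f V by (simp add: borel_open measurable_sets)
  finally show "f -` U \<inter> space M \<in> sets M" .
qed (auto dest: openin_subset)

section \<open>Weak convergence\<close>

lemma distr_in_prob_measures:
  assumes "prob_space M" "g \<in> M \<rightarrow>\<^sub>M borel_of Y"
  shows "distr M (borel_of Y) g \<in> prob_measures Y"
  using assms by (auto simp: prob_measures_def prob_space.prob_space_distr)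

lemma prob_measures_measurable_cong:
  assumes "\<mu> \<in> prob_measures X"
  shows "f \<in> \<mu> \<rightarrow>\<^sub>M N \<longleftrightarrow> f \<in> borel_of X \<rightarrow>\<^sub>M N"
  using assms by (auto simp: prob_measures_def cong: measurable_cong_sets)

text \<open>Integrating \<open>f\<close> against an image law is integrating \<open>f \<circ> g\<close> against the law itself, so the
  preimage of a subbasic open set is again subbasic.\<close>

lemma continuous_map_weak_topology_distr:
  assumes g: "continuous_map X Y g"
  shows "continuous_map (weak_topology X) (weak_topology Y) (\<lambda>\<mu>. distr \<mu> (borel_of Y) g)"
proof -
  let ?B = "\<lambda>X. {{\<mu> \<in> prob_measures X. (\<integral>x. f x \<partial>\<mu>) \<in> U} | f U. f \<in> bounded_continuous X \<and> open U}"
  let ?h = "\<lambda>\<mu>. distr \<mu> (borel_of Y) g"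
  have gm: "g \<in> \<mu> \<rightarrow>\<^sub>M borel_of Y" if "\<mu> \<in> prob_measures X" for \<mu>
    using continuous_map_measurable_borel_of[OF g] that by (simp add: prob_measures_measurable_cong)
  have into: "?h \<mu> \<in> prob_measures Y" if "\<mu> \<in> prob_measures X" for \<mu>
    using distr_in_prob_measures[OF _ gm[OF that]] that by (simp add: prob_measures_def)
  have "continuous_map (weak_topology X) (topology_generated_by (?B Y)) ?h"
  proof (rule continuous_on_generated_topo)
    fix W assume "W \<in> ?B Y"
    then obtain f U where W: "W = {\<mu> \<in> prob_measures Y. (\<integral>x. f x \<partial>\<mu>) \<in> U}"
      and f: "f \<in> bounded_continuous Y" and U: "open U" by blast
    have "(f \<circ> g) ` topspace X \<subseteq> f ` topspace Y"
      using g by (auto simp: continuous_map_def)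
    then have fg: "f \<circ> g \<in> bounded_continuous X"
      using f continuous_map_compose[OF g, of euclideanreal f]
      by (auto simp: bounded_continuous_def intro: bounded_subset)
    have fm: "f \<in> borel_measurable (borel_of Y)"
      using f by (auto simp: bounded_continuous_def intro: continuous_map_real_borel_measurable)
    have int: "(\<integral>x. f x \<partial>?h \<mu>) = (\<integral>x. (f \<circ> g) x \<partial>\<mu>)" if "\<mu> \<in> prob_measures X" for \<mu>
      using integral_distr[OF gm[OF that] fm] by simp
    have "?h -` W \<inter> topspace (weak_topology X) = {\<mu> \<in> prob_measures X. (\<integral>x. (f \<circ> g) x \<partial>\<mu>) \<in> U}"
      using into int by (auto simp: W topspace_weak_topology)
    also have "openin (weak_topology X) \<dots>"
      unfolding weak_topology_def by (rule topology_generated_by_Basis) (use fg U in blast)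
    finally show "openin (weak_topology X) (?h -` W \<inter> topspace (weak_topology X))" .
  next
    have "\<Union>(?B Y) = prob_measures Y"
      using topspace_weak_topology[of Y] unfolding weak_topology_def topology_generated_by_topspace .
    then show "?h ` topspace (weak_topology X) \<subseteq> \<Union>(?B Y)"
      using into by (auto simp: topspace_weak_topology)
  qed
  then show ?thesis by (simp add: weak_topology_def)
qed

text \<open>Pointwise convergence of random elements implies convergence of their laws, by dominated
  convergence.\<close>

lemma limitin_weak_topology_distr_pointwise:
  assumes \<mu>: "\<mu> \<in> prob_measures X"
    and meas: "\<And>n. g n \<in> borel_of X \<rightarrow>\<^sub>M borel_of X"
    and lim: "\<And>x. x \<in> topspace X \<Longrightarrow> limitin X (\<lambda>n. g n x) x sequentially"
  shows "limitin (weak_topology X) (\<lambda>n. distr \<mu> (borel_of X) (g n)) \<mu> sequentially"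
  unfolding limitin_weak_topology
proof (intro conjI ballI always_eventually allI)
  have gm: "g n \<in> \<mu> \<rightarrow>\<^sub>M borel_of X" for n
    using meas \<mu> by (simp add: prob_measures_measurable_cong)
  interpret prob_space \<mu> using \<mu> by (simp add: prob_measures_def)
  have sp: "space \<mu> = topspace X"
    using \<mu> sets_eq_imp_space_eq[of \<mu> "borel_of X"] by (simp add: prob_measures_def space_borel_of)
  show "distr \<mu> (borel_of X) (g n) \<in> prob_measures X" for n
    using distr_in_prob_measures[OF _ gm] \<mu> by (simp add: prob_measures_def)
  fix f assume f: "f \<in> bounded_continuous X"
  then have fm: "f \<in> borel_measurable (borel_of X)"
    by (auto simp: bounded_continuous_def intro: continuous_map_real_borel_measurable)
  obtain B where B: "\<And>x. x \<in> topspace X \<Longrightarrow> norm (f x) \<le> B"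
    using f by (auto simp: bounded_continuous_def bounded_iff)
  have "(\<lambda>n. \<integral>x. f (g n x) \<partial>\<mu>) \<longlonglongrightarrow> (\<integral>x. f x \<partial>\<mu>)"
  proof (rule integral_dominated_convergence[where w = "\<lambda>_. B"])
    show "f \<in> borel_measurable \<mu>"
      using fm \<mu> by (simp add: prob_measures_measurable_cong)
    show "(\<lambda>x. f (g n x)) \<in> borel_measurable \<mu>" for n
      using measurable_compose[OF gm fm] .
    show "AE x in \<mu>. (\<lambda>n. f (g n x)) \<longlonglongrightarrow> f x"
    proof (rule AE_I2)
      fix x assume "x \<in> space \<mu>"
      then have "limitin X (\<lambda>n. g n x) x sequentially"
        using lim sp by simp
      moreover have "continuous_map X euclideanreal f"
        using f by (simp add: bounded_continuous_def)
      ultimately have "limitin euclideanreal (f \<circ> (\<lambda>n. g n x)) (f x) sequentially"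
        by (rule continuous_map_limit[rotated])
      then show "(\<lambda>n. f (g n x)) \<longlonglongrightarrow> f x"
        by (simp add: o_def)
    qed
    show "AE x in \<mu>. norm (f (g n x)) \<le> B" for n
      using measurable_space[OF gm] B by (intro AE_I2) (simp add: space_borel_of)
  qed simp
  then show "(\<lambda>n. \<integral>x. f x \<partial>distr \<mu> (borel_of X) (g n)) \<longlonglongrightarrow> (\<integral>x. f x \<partial>\<mu>)"
    by (simp add: integral_distr[OF gm fm])
qed (fact assms)

section \<open>The Skorokhod metric\<close>

lemma cadlag_right_near:
  assumes "x \<in> cadlag_paths T" "0 \<le> t" "t < T" "e > 0"
  obtains d where "d > 0" "t + d \<le> T" "\<And>s. t \<le> s \<Longrightarrow> s < t + d \<Longrightarrow> \<bar>x s - x t\<bar> < e"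
proof -
  have "(x \<longlongrightarrow> x t) (at_right t)" using assms by (auto simp: cadlag_paths_def)
  then have "\<forall>\<^sub>F s in at_right t. dist (x s) (x t) < e" using assms by (intro tendstoD)
  then obtain b where b: "b > t" "\<And>s. s > t \<Longrightarrow> s < b \<Longrightarrow> dist (x s) (x t) < e"
    by (auto simp: eventually_at_right_field)
  show thesis
  proof (rule that[of "min (b - t) (T - t)"])
    fix s assume "t \<le> s" "s < t + min (b - t) (T - t)"
    then show "\<bar>x s - x t\<bar> < e"
      using b(2)[of s] assms by (cases "s = t") (auto simp: dist_real_def)
  qed (use b assms in auto)
qed

lemma cadlag_left_near:
  assumes "x \<in> cadlag_paths T" "0 < t" "t \<le> T" "e > 0"
  obtains d l where "d > 0" "d \<le> t" "\<And>s. t - d < s \<Longrightarrow> s < t \<Longrightarrow> \<bar>x s - l\<bar> < e"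
proof -
  have "\<exists>l. (x \<longlongrightarrow> l) (at_left t)" using assms by (simp add: cadlag_paths_def)
  then obtain l where "(x \<longlongrightarrow> l) (at_left t)" by blast
  then have "\<forall>\<^sub>F s in at_left t. dist (x s) l < e" using assms by (intro tendstoD)
  then obtain b where b: "b < t" "\<And>s. s > b \<Longrightarrow> s < t \<Longrightarrow> dist (x s) l < e"
    by (auto simp: eventually_at_left_field)
  show thesis
    by (rule that[of "min (t - b) t" l]) (use b assms in \<open>auto simp: dist_real_def\<close>)
qed

text \<open>The suprema in the Skorokhod distance are suprema of bounded sets only because cadlag paths
  are bounded. A path is bounded near each time by its one-sided limits there, and
  \<open>Bolzano\<close>, a form of compactness of the interval, passes from short intervals to all of them.\<close>

lemma cadlag_bounded:
  assumes x: "x \<in> cadlag_paths T" and T: "T \<ge> 0"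
  shows "\<exists>B. \<forall>t\<in>{0..T}. \<bar>x t\<bar> \<le> B"
proof -
  have "\<exists>B. \<forall>t\<in>{0..T} \<inter> {0..T}. \<bar>x t\<bar> \<le> B"
  proof (rule Bolzano[OF T, where P = "\<lambda>a b. \<exists>B. \<forall>t\<in>{a..b} \<inter> {0..T}. \<bar>x t\<bar> \<le> B"])
    fix a b c :: real
    assume "\<exists>B. \<forall>t\<in>{a..b} \<inter> {0..T}. \<bar>x t\<bar> \<le> B" "\<exists>B. \<forall>t\<in>{b..c} \<inter> {0..T}. \<bar>x t\<bar> \<le> B"
    then obtain B C where "\<forall>t\<in>{a..b} \<inter> {0..T}. \<bar>x t\<bar> \<le> B" "\<forall>t\<in>{b..c} \<inter> {0..T}. \<bar>x t\<bar> \<le> C"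
      by blast
    then have "\<forall>t\<in>{a..c} \<inter> {0..T}. \<bar>x t\<bar> \<le> max B C"
      by (metis IntD1 IntD2 IntI atLeastAtMost_iff linear max.coboundedI1 max.coboundedI2)
    then show "\<exists>B. \<forall>t\<in>{a..c} \<inter> {0..T}. \<bar>x t\<bar> \<le> B" by blast
  next
    fix s assume s: "0 \<le> s" "s \<le> T"
    have "\<exists>d>0. \<exists>B. \<forall>t\<in>{s<..<s+d} \<inter> {0..T}. \<bar>x t\<bar> \<le> B"
    proof (cases "s < T")
      case True
      then obtain d where d: "d > 0" "\<And>t. s \<le> t \<Longrightarrow> t < s + d \<Longrightarrow> \<bar>x t - x s\<bar> < 1"
        using cadlag_right_near[OF x s(1), of 1] by auto
      have "\<bar>x t\<bar> \<le> \<bar>x s\<bar> + 1" if "t \<in> {s<..<s+d} \<inter> {0..T}" for t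
        using d(2)[of t] that by auto
      then show ?thesis using d(1) by blast
    qed (use s in \<open>auto intro!: exI[of _ 1]\<close>)
    then obtain d1 B1 where d1: "d1 > 0" "\<And>t. t \<in> {s<..<s+d1} \<inter> {0..T} \<Longrightarrow> \<bar>x t\<bar> \<le> B1" by blast
    have "\<exists>d>0. \<exists>B. \<forall>t\<in>{s-d<..<s} \<inter> {0..T}. \<bar>x t\<bar> \<le> B"
    proof (cases "0 < s")
      case True
      then obtain d l where d: "d > 0" "\<And>t. s - d < t \<Longrightarrow> t < s \<Longrightarrow> \<bar>x t - l\<bar> < 1"
        using cadlag_left_near[OF x True s(2), of 1] by (metis zero_less_one)
      have "\<bar>x t\<bar> \<le> \<bar>l\<bar> + 1" if "t \<in> {s-d<..<s} \<inter> {0..T}" for t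
        using d(2)[of t] that by auto
      then show ?thesis using d(1) by blast
    qed (use s in \<open>auto intro!: exI[of _ 1]\<close>)
    then obtain d2 B2 where d2: "d2 > 0" "\<And>t. t \<in> {s-d2<..<s} \<inter> {0..T} \<Longrightarrow> \<bar>x t\<bar> \<le> B2" by blast
    show "\<exists>d>0. \<forall>a b. a \<le> s \<and> s \<le> b \<and> b - a < d \<longrightarrow> (\<exists>B. \<forall>t\<in>{a..b} \<inter> {0..T}. \<bar>x t\<bar> \<le> B)"
    proof (rule exI[of _ "min d1 d2"], intro conjI allI impI)
      fix a b assume ab: "a \<le> s \<and> s \<le> b \<and> b - a < min d1 d2"
      have "\<bar>x t\<bar> \<le> max \<bar>x s\<bar> (max B1 B2)" if t: "t \<in> {a..b} \<inter> {0..T}" for t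
      proof (cases t s rule: linorder_cases)
        case less
        then have "\<bar>x t\<bar> \<le> B2" using ab t by (intro d2) auto
        then show ?thesis by simp
      next
        case greater
        then have "\<bar>x t\<bar> \<le> B1" using ab t by (intro d1) auto
        then show ?thesis by simp
      qed simp
      then show "\<exists>B. \<forall>t\<in>{a..b} \<inter> {0..T}. \<bar>x t\<bar> \<le> B" by blast
    qed (use d1 d2 in auto)
  qed
  then show ?thesis by simp
qed

lemma time_changesD:
  assumes "\<theta> \<in> time_changes T"
  shows "\<And>s t. s \<in> {0..T} \<Longrightarrow> t \<in> {0..T} \<Longrightarrow> s < t \<Longrightarrow> \<theta> s < \<theta> t"
    and "continuous_on {0..T} \<theta>" and "\<theta> ` {0..T} = {0..T}"
    and "\<And>t. t \<in> {0..T} \<Longrightarrow> \<theta> t \<in> {0..T}"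
  using assms by (auto simp: time_changes_def strict_mono_on_def)

lemma time_changes_end:
  assumes \<theta>: "\<theta> \<in> time_changes T" and T: "T \<ge> 0"
  shows "\<theta> T = T"
proof -
  obtain t where t: "t \<in> {0..T}" "\<theta> t = T"
    using time_changesD(3)[OF \<theta>] T by (metis atLeastAtMost_iff imageE order_refl)
  have "t = T"
  proof (rule ccontr)
    assume "t \<noteq> T"
    then have "\<theta> t < \<theta> T" using t T by (intro time_changesD(1)[OF \<theta>]) auto
    then show False using time_changesD(4)[OF \<theta>, of T] t T by auto
  qed
  then show ?thesis using t by simp
qed

lemma time_changes_id: "(\<lambda>t. t) \<in> time_changes T"
  by (auto simp: time_changes_def strict_mono_on_def)

lemma time_changes_compose:
  assumes \<theta>: "\<theta> \<in> time_changes T" and \<eta>: "\<eta> \<in> time_changes T"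
  shows "(\<lambda>t. \<eta> (\<theta> t)) \<in> time_changes T"
proof -
  have "continuous_on {0..T} (\<lambda>t. \<eta> (\<theta> t))"
    using continuous_on_compose2[of "{0..T}" \<eta> "{0..T}" \<theta>] time_changesD[OF \<theta>] time_changesD[OF \<eta>] by simp
  moreover have "strict_mono_on {0..T} (\<lambda>t. \<eta> (\<theta> t))"
    using time_changesD(1,4)[OF \<theta>] time_changesD(1)[OF \<eta>] by (auto simp: strict_mono_on_def)
  moreover have "(\<lambda>t. \<eta> (\<theta> t)) ` {0..T} = {0..T}"
    using time_changesD(3)[OF \<theta>] time_changesD(3)[OF \<eta>] by (metis image_image)
  ultimately show ?thesis by (simp add: time_changes_def)
qed

lemma time_changes_inverse:
  assumes \<theta>: "\<theta> \<in> time_changes T"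
  obtains \<eta> where "\<eta> \<in> time_changes T" "\<And>t. t \<in> {0..T} \<Longrightarrow> \<eta> (\<theta> t) = t"
    "\<And>t. t \<in> {0..T} \<Longrightarrow> \<theta> (\<eta> t) = t"
proof -
  note D = time_changesD[OF \<theta>]
  define \<eta> where "\<eta> = the_inv_into {0..T} \<theta>"
  have inj: "inj_on \<theta> {0..T}"
    using \<theta> by (auto simp: time_changes_def intro: strict_mono_on_imp_inj_on)
  have l: "\<eta> (\<theta> t) = t" if "t \<in> {0..T}" for t
    using the_inv_into_f_f[OF inj that] by (simp add: \<eta>_def)
  have r: "\<theta> (\<eta> t) = t" if "t \<in> {0..T}" for t
    using f_the_inv_into_f[OF inj, of t] that D(3) by (simp add: \<eta>_def)
  have im: "\<eta> ` {0..T} = {0..T}"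
    using the_inv_into_onto[OF inj] D(3) by (simp add: \<eta>_def)
  have "continuous_on {0..T} \<eta>"
    using continuous_on_inv[OF D(2), of \<eta>] l D(3) by simp
  moreover have "strict_mono_on {0..T} \<eta>"
  proof (rule strict_mono_onI)
    fix s t :: real assume st: "s \<in> {0..T}" "t \<in> {0..T}" "s < t"
    then have m: "\<eta> s \<in> {0..T}" "\<eta> t \<in> {0..T}" using im by auto
    show "\<eta> s < \<eta> t"
    proof (rule ccontr)
      assume "\<not> \<eta> s < \<eta> t"
      then have "\<theta> (\<eta> t) \<le> \<theta> (\<eta> s)"
        using D(1)[OF m(2,1)] by (cases "\<eta> t = \<eta> s") auto
      then show False using r st by simp
    qed
  qed
  ultimately have "\<eta> \<in> time_changes T" using im by (simp add: time_changes_def)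
  with l r that show thesis by blast
qed

lemma time_changes_displacement_le:
  assumes "\<theta> \<in> time_changes T" "t \<in> {0..T}"
  shows "\<bar>\<theta> t - t\<bar> \<le> T"
  using time_changesD(4)[OF assms] assms(2) by auto

abbreviation distortion :: "real \<Rightarrow> (real \<Rightarrow> real) \<Rightarrow> (real \<Rightarrow> real) \<Rightarrow> (real \<Rightarrow> real) \<Rightarrow> real" where
  "distortion T x y \<theta> \<equiv> max (SUP t\<in>{0..T}. \<bar>\<theta> t - t\<bar>) (SUP t\<in>{0..T}. \<bar>x t - y (\<theta> t)\<bar>)"

lemma distortion_nonneg:
  assumes "\<theta> \<in> time_changes T" "T \<ge> 0"
  shows "0 \<le> distortion T x y \<theta>"
proof -
  have "\<bar>\<theta> 0 - 0\<bar> \<le> (SUP t\<in>{0..T}. \<bar>\<theta> t - t\<bar>)"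
    by (rule cSUP_upper) (use assms time_changes_displacement_le in \<open>auto intro!: bdd_aboveI2[where M = T]\<close>)
  then show ?thesis by linarith
qed

lemma bdd_below_distortion:
  "T \<ge> 0 \<Longrightarrow> bdd_below (distortion T x y ` time_changes T)"
  using distortion_nonneg by (intro bdd_belowI2[where m = 0]) auto

lemma skorokhod_dist_nonneg: "T \<ge> 0 \<Longrightarrow> 0 \<le> skorokhod_dist T x y"
  unfolding skorokhod_dist_def
  using time_changes_id[of T] distortion_nonneg[of _ T x y] by (intro cINF_greatest) blast+

text \<open>This lemma and the next replace the infimum over time changes and the suprema over times by a
  single time change with pointwise bounds; all later estimates go through them.\<close>

lemma skorokhod_dist_le:
  assumes T: "T \<ge> 0" and \<theta>: "\<theta> \<in> time_changes T"
    and "\<And>t. t \<in> {0..T} \<Longrightarrow> \<bar>\<theta> t - t\<bar> \<le> e"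
    and "\<And>t. t \<in> {0..T} \<Longrightarrow> \<bar>x t - y (\<theta> t)\<bar> \<le> e"
  shows "skorokhod_dist T x y \<le> e"
proof -
  have "skorokhod_dist T x y \<le> distortion T x y \<theta>"
    unfolding skorokhod_dist_def by (rule cINF_lower[OF bdd_below_distortion[OF T] \<theta>])
  also have "\<dots> \<le> e"
    using assms by (auto intro!: cSUP_least)
  finally show ?thesis .
qed

lemma skorokhod_dist_less:
  assumes T: "T \<ge> 0" and x: "x \<in> cadlag_paths T" and y: "y \<in> cadlag_paths T"
    and less: "skorokhod_dist T x y < e"
  obtains \<theta> where "\<theta> \<in> time_changes T" "\<And>t. t \<in> {0..T} \<Longrightarrow> \<bar>\<theta> t - t\<bar> < e"
    "\<And>t. t \<in> {0..T} \<Longrightarrow> \<bar>x t - y (\<theta> t)\<bar> < e"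
proof -
  obtain \<theta> where \<theta>: "\<theta> \<in> time_changes T" and le: "distortion T x y \<theta> < e"
    using less time_changes_id unfolding skorokhod_dist_def
    by (subst (asm) cINF_less_iff[OF _ bdd_below_distortion[OF T]]) auto
  obtain B C where BC: "\<And>t. t \<in> {0..T} \<Longrightarrow> \<bar>x t\<bar> \<le> B" "\<And>t. t \<in> {0..T} \<Longrightarrow> \<bar>y t\<bar> \<le> C"
    using cadlag_bounded[OF x T] cadlag_bounded[OF y T] by blast
  have bdd: "\<bar>x t - y (\<theta> t)\<bar> \<le> B + C" if "t \<in> {0..T}" for t
    using BC(1)[OF that] BC(2)[OF time_changesD(4)[OF \<theta> that]] by linarith
  have "\<bar>\<theta> t - t\<bar> < e" "\<bar>x t - y (\<theta> t)\<bar> < e" if t: "t \<in> {0..T}" for t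
  proof -
    have "\<bar>\<theta> t - t\<bar> \<le> (SUP t\<in>{0..T}. \<bar>\<theta> t - t\<bar>)"
      by (rule cSUP_upper[OF t]) (use \<theta> time_changes_displacement_le in \<open>auto intro!: bdd_aboveI2[where M = T]\<close>)
    then show "\<bar>\<theta> t - t\<bar> < e" using le by linarith
    have "\<bar>x t - y (\<theta> t)\<bar> \<le> (SUP t\<in>{0..T}. \<bar>x t - y (\<theta> t)\<bar>)"
      by (rule cSUP_upper[OF t]) (use bdd in \<open>auto intro!: bdd_aboveI2[where M = "B + C"]\<close>)
    then show "\<bar>x t - y (\<theta> t)\<bar> < e" using le by linarith
  qed
  with \<theta> that show thesis by blast
qed

text \<open>Substituting \<open>t \<mapsto> \<eta> t\<close>, with \<open>\<eta>\<close> the inverse time change, turns the values under each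
  supremum into one another. Comparing these sets rather than bounding the suprema gives symmetry
  for all functions, also unbounded ones; the axioms of a metric space ask for symmetry outside the
  carrier too.\<close>

lemma distortion_inverse:
  assumes \<theta>: "\<theta> \<in> time_changes T"
  shows "\<exists>\<eta>\<in>time_changes T. distortion T x y \<theta> = distortion T y x \<eta>"
proof -
  obtain \<eta> where \<eta>: "\<eta> \<in> time_changes T" and inv: "\<And>t. t \<in> {0..T} \<Longrightarrow> \<eta> (\<theta> t) = t"
    "\<And>t. t \<in> {0..T} \<Longrightarrow> \<theta> (\<eta> t) = t"
    using time_changes_inverse[OF \<theta>] by blast
  have im: "f ` {0..T} = (\<lambda>t. f (\<eta> t)) ` {0..T}" for f :: "real \<Rightarrow> real"
    using time_changesD(3)[OF \<eta>] by (metis image_image)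
  have "(\<lambda>t. \<bar>\<theta> t - t\<bar>) ` {0..T} = (\<lambda>t. \<bar>\<eta> t - t\<bar>) ` {0..T}"
    unfolding im[of "\<lambda>t. \<bar>\<theta> t - t\<bar>"] by (rule image_cong) (auto simp: inv)
  moreover have "(\<lambda>t. \<bar>x t - y (\<theta> t)\<bar>) ` {0..T} = (\<lambda>t. \<bar>y t - x (\<eta> t)\<bar>) ` {0..T}"
    unfolding im[of "\<lambda>t. \<bar>x t - y (\<theta> t)\<bar>"] by (rule image_cong) (auto simp: inv)
  ultimately show ?thesis using \<eta> by (intro bexI[of _ \<eta>]) simp_all
qed

lemma skorokhod_dist_commute: "skorokhod_dist T x y = skorokhod_dist T y x"
proof -
  have "distortion T x y ` time_changes T \<subseteq> distortion T y x ` time_changes T" for x y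
  proof
    fix r assume "r \<in> distortion T x y ` time_changes T"
    then obtain \<theta> where "\<theta> \<in> time_changes T" "r = distortion T x y \<theta>" by blast
    then show "r \<in> distortion T y x ` time_changes T"
      using distortion_inverse[of \<theta> T x y] by blast
  qed
  then have "distortion T x y ` time_changes T = distortion T y x ` time_changes T"
    by (intro subset_antisym)
  then show ?thesis by (simp add: skorokhod_dist_def)
qed

lemma skorokhod_dist_triangle:
  assumes T: "T \<ge> 0" and x: "x \<in> cadlag_paths T" and y: "y \<in> cadlag_paths T" and z: "z \<in> cadlag_paths T"
  shows "skorokhod_dist T x z \<le> skorokhod_dist T x y + skorokhod_dist T y z"
proof (rule field_le_epsilon)
  fix e :: real assume e: "e > 0"
  define a b where "a = skorokhod_dist T x y + e/2" and "b = skorokhod_dist T y z + e/2"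
  have less_a: "skorokhod_dist T x y < a" and less_b: "skorokhod_dist T y z < b"
    using e by (simp_all add: a_def b_def)
  obtain \<theta> where \<theta>: "\<theta> \<in> time_changes T"
    "\<And>t. t \<in> {0..T} \<Longrightarrow> \<bar>\<theta> t - t\<bar> < a"
    "\<And>t. t \<in> {0..T} \<Longrightarrow> \<bar>x t - y (\<theta> t)\<bar> < a"
    using skorokhod_dist_less[OF T x y less_a] by metis
  obtain \<eta> where \<eta>: "\<eta> \<in> time_changes T"
    "\<And>t. t \<in> {0..T} \<Longrightarrow> \<bar>\<eta> t - t\<bar> < b"
    "\<And>t. t \<in> {0..T} \<Longrightarrow> \<bar>y t - z (\<eta> t)\<bar> < b"
    using skorokhod_dist_less[OF T y z less_b] by metis
  have "skorokhod_dist T x z \<le> a + b"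
  proof (rule skorokhod_dist_le[OF T time_changes_compose[OF \<theta>(1) \<eta>(1)]])
    fix t assume t: "t \<in> {0..T}"
    note t' = time_changesD(4)[OF \<theta>(1) t]
    show "\<bar>\<eta> (\<theta> t) - t\<bar> \<le> a + b" using \<theta>(2)[OF t] \<eta>(2)[OF t'] by linarith
    show "\<bar>x t - z (\<eta> (\<theta> t))\<bar> \<le> a + b" using \<theta>(3)[OF t] \<eta>(3)[OF t'] by linarith
  qed
  then show "skorokhod_dist T x z \<le> skorokhod_dist T x y + skorokhod_dist T y z + e"
    by (simp add: a_def b_def)
qed

text \<open>Two paths at distance \<open>0\<close> agree at \<open>T\<close>, which every time change fixes. A small time
  change may move an earlier time \<open>t\<close> to its left, across a jump. The comparison is therefore made
  slightly to the right of \<open>t\<close>: there a small enough time change stays to the right of \<open>t\<close>, and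
  right-continuity of both paths applies.\<close>

lemma skorokhod_dist_eq_0_imp_eq:
  assumes T: "T \<ge> 0" and x: "x \<in> cadlag_paths T" and y: "y \<in> cadlag_paths T"
    and 0: "skorokhod_dist T x y = 0"
  shows "x = y"
proof (rule extensionalityI)
  show "x \<in> extensional {0..T}" "y \<in> extensional {0..T}"
    using x y by (auto simp: cadlag_paths_def)
  fix t assume t: "t \<in> {0..T}"
  show "x t = y t"
  proof (rule ccontr)
    assume ne: "x t \<noteq> y t"
    define e where "e = \<bar>x t - y t\<bar> / 3"
    have e: "e > 0" using ne by (simp add: e_def)
    show False
    proof (cases "t < T")
      case True
      obtain d1 where d1: "d1 > 0" "t + d1 \<le> T" "\<And>s. t \<le> s \<Longrightarrow> s < t + d1 \<Longrightarrow> \<bar>x s - x t\<bar> < e"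
        using cadlag_right_near[OF x _ True e] t by auto
      obtain d2 where d2: "d2 > 0" "t + d2 \<le> T" "\<And>s. t \<le> s \<Longrightarrow> s < t + d2 \<Longrightarrow> \<bar>y s - y t\<bar> < e"
        using cadlag_right_near[OF y _ True e] t by auto
      define d where "d = min d1 d2"
      have d: "d > 0" "d \<le> d1" "d \<le> d2" using d1 d2 by (auto simp: d_def)
      have less: "skorokhod_dist T x y < min (d/2) e" using 0 d e by simp
      obtain \<theta> where \<theta>: "\<theta> \<in> time_changes T"
        "\<And>t. t \<in> {0..T} \<Longrightarrow> \<bar>\<theta> t - t\<bar> < min (d/2) e"
        "\<And>t. t \<in> {0..T} \<Longrightarrow> \<bar>x t - y (\<theta> t)\<bar> < min (d/2) e"
        using skorokhod_dist_less[OF T x y less] by metis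
      (* Midpoint: a displacement below d/2 keeps its image inside (t, t + d). *)
      define s where "s = t + d/2"
      have s: "s \<in> {0..T}" using d d1 t by (auto simp: s_def)
      have "t \<le> \<theta> s" "\<theta> s < t + d2" "t \<le> s" "s < t + d1"
      proof -
        have "\<bar>\<theta> s - s\<bar> < d/2" using \<theta>(2)[OF s] by simp
        then show "t \<le> \<theta> s" "\<theta> s < t + d2" "t \<le> s" "s < t + d1"
          using d unfolding s_def by linarith+
      qed
      then have "\<bar>y (\<theta> s) - y t\<bar> < e" "\<bar>x s - x t\<bar> < e"
        using d1(3) d2(3) by auto
      moreover have "\<bar>x s - y (\<theta> s)\<bar> < e" using \<theta>(3)[OF s] by simp
      moreover have "\<bar>x t - y t\<bar> = 3 * e" by (simp add: e_def)
      ultimately show False by linarith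
    next
      case False
      then have tT: "t = T" using t by simp
      have less: "skorokhod_dist T x y < e" using 0 e by simp
      obtain \<theta> where \<theta>: "\<theta> \<in> time_changes T"
        "\<And>t. t \<in> {0..T} \<Longrightarrow> \<bar>\<theta> t - t\<bar> < e"
        "\<And>t. t \<in> {0..T} \<Longrightarrow> \<bar>x t - y (\<theta> t)\<bar> < e"
        using skorokhod_dist_less[OF T x y less] by metis
      have "\<bar>x t - y t\<bar> < e" using \<theta>(3)[OF t] time_changes_end[OF \<theta>(1) T] tT by simp
      then show False by (simp add: e_def)
    qed
  qed
qed

lemma Metric_space_skorokhod:
  assumes T: "T \<ge> 0"
  shows "Metric_space (cadlag_paths T) (skorokhod_dist T)"
proof
  fix x y z
  show "0 \<le> skorokhod_dist T x y" by (rule skorokhod_dist_nonneg[OF T])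
  show "skorokhod_dist T x y = skorokhod_dist T y x" by (rule skorokhod_dist_commute)
  assume xy: "x \<in> cadlag_paths T" "y \<in> cadlag_paths T"
  have "skorokhod_dist T x x = 0"
    using skorokhod_dist_le[OF T time_changes_id, of 0 x x] skorokhod_dist_nonneg[OF T, of x x] by simp
  then show "skorokhod_dist T x y = 0 \<longleftrightarrow> x = y"
    using skorokhod_dist_eq_0_imp_eq[OF T xy] by auto
  assume "z \<in> cadlag_paths T"
  then show "skorokhod_dist T x z \<le> skorokhod_dist T x y + skorokhod_dist T y z"
    using skorokhod_dist_triangle[OF T] xy by blast
qed

lemma topspace_skorokhod: "T \<ge> 0 \<Longrightarrow> topspace (skorokhod T) = cadlag_paths T"
  unfolding skorokhod_def by (rule Metric_space.topspace_mtopology[OF Metric_space_skorokhod])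

section \<open>Measurability of the coordinates\<close>

lemma openin_skorokhodI:
  assumes T: "T \<ge> 0" and sub: "U \<subseteq> cadlag_paths T"
    and near: "\<And>x. x \<in> U \<Longrightarrow> \<exists>r>0. \<forall>y\<in>cadlag_paths T. skorokhod_dist T x y < r \<longrightarrow> y \<in> U"
  shows "openin (skorokhod T) U"
proof -
  interpret Metric_space "cadlag_paths T" "skorokhod_dist T" by (rule Metric_space_skorokhod[OF T])
  have "\<exists>r>0. mball x r \<subseteq> U" if "x \<in> U" for x
    using near[OF that] by (auto simp: subset_iff)
  then show ?thesis unfolding skorokhod_def openin_mtopology using sub by auto
qed

text \<open>Evaluation at a time \<open>t < T\<close> is not continuous, but the supremum over an open interval is lower
  semicontinuous: a small time change keeps a point of the interval inside it.\<close>

lemma openin_skorokhod_exceeds: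
  assumes T: "T \<ge> 0" and ab: "0 \<le> a" "b \<le> T"
  shows "openin (skorokhod T) {x \<in> cadlag_paths T. \<exists>s\<in>{a<..<b}. x s > c}"
proof (rule openin_skorokhodI[OF T])
  fix x assume "x \<in> {x \<in> cadlag_paths T. \<exists>s\<in>{a<..<b}. x s > c}"
  then obtain s where x: "x \<in> cadlag_paths T" and s: "a < s" "s < b" "x s > c" by auto
  define r where "r = min (x s - c) (min (s - a) (b - s))"
  have sT: "s \<in> {0..T}" using s ab by simp
  have "y \<in> {x \<in> cadlag_paths T. \<exists>s\<in>{a<..<b}. x s > c}"
    if y: "y \<in> cadlag_paths T" and d: "skorokhod_dist T x y < r" for y
  proof -
    obtain \<theta> where \<theta>: "\<theta> \<in> time_changes T"
      "\<And>t. t \<in> {0..T} \<Longrightarrow> \<bar>\<theta> t - t\<bar> < r"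
      "\<And>t. t \<in> {0..T} \<Longrightarrow> \<bar>x t - y (\<theta> t)\<bar> < r"
      using skorokhod_dist_less[OF T x y d] by metis
    have "\<theta> s \<in> {a<..<b}" "y (\<theta> s) > c"
      using \<theta>(2,3)[OF sT] by (auto simp: r_def abs_less_iff)
    with y show ?thesis by blast
  qed
  moreover have "r > 0" using s by (simp add: r_def)
  ultimately show "\<exists>r>0. \<forall>y\<in>cadlag_paths T. skorokhod_dist T x y < r \<longrightarrow>
      y \<in> {x \<in> cadlag_paths T. \<exists>s\<in>{a<..<b}. x s > c}" by blast
qed auto

lemma openin_skorokhod_endpoint:
  assumes T: "T \<ge> 0"
  shows "openin (skorokhod T) {x \<in> cadlag_paths T. x T > c}"
proof (rule openin_skorokhodI[OF T])
  fix x assume x: "x \<in> {x \<in> cadlag_paths T. x T > c}"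
  then have x0: "x \<in> cadlag_paths T" by simp
  have "y T > c" if y: "y \<in> cadlag_paths T" and d: "skorokhod_dist T x y < x T - c" for y
  proof -
    obtain \<theta> where \<theta>: "\<theta> \<in> time_changes T"
      "\<And>t. t \<in> {0..T} \<Longrightarrow> \<bar>\<theta> t - t\<bar> < x T - c"
      "\<And>t. t \<in> {0..T} \<Longrightarrow> \<bar>x t - y (\<theta> t)\<bar> < x T - c"
      using skorokhod_dist_less[OF T x0 y d] by metis
    show ?thesis using \<theta>(3)[of T] time_changes_end[OF \<theta>(1) T] T by (simp add: abs_less_iff)
  qed
  then show "\<exists>r>0. \<forall>y\<in>cadlag_paths T. skorokhod_dist T x y < r \<longrightarrow> y \<in> {x \<in> cadlag_paths T. x T > c}"
    using x by (intro exI[of _ "x T - c"]) auto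
qed auto

text \<open>By right-continuity, \<open>x t > c\<close> holds iff, for some \<open>n\<close>, the path exceeds \<open>c + 1 / Suc n\<close>
  somewhere in every interval to the right of \<open>t\<close>. This is a countable combination of the open
  sets of \<open>openin_skorokhod_exceeds\<close>. At \<open>t = T\<close> evaluation is continuous, since time changes
  fix \<open>T\<close>.\<close>

lemma coordinate_borel_measurable:
  assumes T: "T \<ge> 0" and t: "t \<in> {0..T}"
  shows "(\<lambda>x. x t) \<in> borel_measurable (borel_of (skorokhod T))"
proof (rule borel_measurableI_greater)
  fix c :: real
  have sp: "space (borel_of (skorokhod T)) = cadlag_paths T"
    by (simp add: space_borel_of topspace_skorokhod[OF T])
  show "{x \<in> space (borel_of (skorokhod T)). c < x t} \<in> sets (borel_of (skorokhod T))"
  proof (cases "t = T")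
    case True
    then show ?thesis
      using openin_in_sets_borel_of[OF openin_skorokhod_endpoint[OF T, of c]] by (simp add: sp)
  next
    case False
    then have tT: "t < T" "0 \<le> t" using t by auto
    define A where "A n m = {x \<in> cadlag_paths T.
      \<exists>s\<in>{t<..<min T (t + 1 / Suc m)}. x s > c + 1 / Suc n}" for n m :: nat
    have A: "A n m \<in> sets (borel_of (skorokhod T))" for n m
      unfolding A_def using tT by (intro openin_in_sets_borel_of openin_skorokhod_exceeds[OF T]) auto
    have "c < x t \<longleftrightarrow> (\<exists>n. \<forall>m. x \<in> A n m)" if x: "x \<in> cadlag_paths T" for x
    proof
      assume "c < x t"
      define e where "e = (x t - c) / 2"
      have e: "e > 0" "x t = c + 2 * e" using \<open>c < x t\<close> by (simp_all add: e_def field_simps)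
      obtain n where n: "1 / real (Suc n) < e"
        using reals_Archimedean[OF e(1)] by (auto simp: inverse_eq_divide)
      obtain d where d: "d > 0" "t + d \<le> T" "\<And>s. t \<le> s \<Longrightarrow> s < t + d \<Longrightarrow> \<bar>x s - x t\<bar> < e"
        using cadlag_right_near[OF x tT(2,1) e(1)] by metis
      have "x \<in> A n m" for m
      proof -
        define r where "r = min d (1 / Suc m)"
        have r: "0 < r" "r \<le> d" "r \<le> 1 / Suc m" using d by (auto simp: r_def)
        define s where "s = t + r / 2"
        have s: "s \<in> {t<..<min T (t + 1 / Suc m)}" "t \<le> s" "s < t + d"
          using d(2) r by (simp_all add: s_def)
        have "x s > c + 1 / Suc n"
          using d(3)[OF s(2,3)] n e by linarith
        then show ?thesis using x s(1) by (auto simp: A_def)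
      qed
      then show "\<exists>n. \<forall>m. x \<in> A n m" by blast
    next
      assume "\<exists>n. \<forall>m. x \<in> A n m"
      then obtain n where n: "\<And>m. x \<in> A n m" by blast
      show "c < x t"
      proof (rule ccontr)
        assume "\<not> c < x t"
        obtain d where d: "d > 0" "\<And>s. t \<le> s \<Longrightarrow> s < t + d \<Longrightarrow> \<bar>x s - x t\<bar> < 1 / Suc n"
          using cadlag_right_near[OF x tT(2,1), of "1 / Suc n"] by auto
        obtain m where "1 / Suc m < d"
          using reals_Archimedean[OF d(1)] by (auto simp: inverse_eq_divide)
        with n[of m] obtain s where "t < s" "s < t + d" "x s > c + 1 / Suc n"
          by (auto simp: A_def)
        then show False using d(2)[of s] \<open>\<not> c < x t\<close> by linarith
      qed
    qed
    moreover have "x \<in> cadlag_paths T" if "x \<in> A n m" for x n m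
      using that by (simp add: A_def)
    ultimately have "x \<in> cadlag_paths T \<and> c < x t \<longleftrightarrow> (\<exists>n. \<forall>m. x \<in> A n m)" for x
      by metis
    then have "{x \<in> space (borel_of (skorokhod T)). c < x t} = (\<Union>n. \<Inter>m. A n m)"
      unfolding sp by (simp add: set_eq_iff)
    also have "\<dots> \<in> sets (borel_of (skorokhod T))"
      using A by (intro sets.countable_UN sets.countable_INT) auto
    finally show ?thesis .
  qed
qed

section \<open>Step paths\<close>

text \<open>At \<open>t = T\<close> the index is \<open>N\<close>, so that a step path has \<open>N + 1\<close> free values: one for each step
  and one for the endpoint.\<close>

definition step_index :: "real \<Rightarrow> nat \<Rightarrow> real \<Rightarrow> nat" where
  "step_index T N t = nat \<lfloor>t * real N / T\<rfloor>"

definition step_path :: "real \<Rightarrow> nat \<Rightarrow> (nat \<Rightarrow> real) \<Rightarrow> real \<Rightarrow> real" where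
  "step_path T N v = (\<lambda>t\<in>{0..T}. v (step_index T N t))"

definition grid_values :: "real \<Rightarrow> nat \<Rightarrow> (real \<Rightarrow> real) \<Rightarrow> nat \<Rightarrow> real" where
  "grid_values T N x = (\<lambda>i. if i < Suc N then x (real i * T / real N) else 0)"

lemma step_index_eqI:
  assumes "T > 0" "N \<ge> 1" "real k * T / real N \<le> t" "t < (real k + 1) * T / real N"
  shows "step_index T N t = k"
proof -
  have "\<lfloor>t * real N / T\<rfloor> = int k"
    using assms by (intro floor_unique) (auto simp: field_simps)
  then show ?thesis by (simp add: step_index_def)
qed

lemma step_index_bounds:
  assumes "T > 0" "N \<ge> 1" "t \<ge> 0"
  shows "real (step_index T N t) * T / real N \<le> t" "t < (real (step_index T N t) + 1) * T / real N"
proof -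
  have "real (step_index T N t) = of_int \<lfloor>t * real N / T\<rfloor>"
    using assms by (simp add: step_index_def)
  then have "real (step_index T N t) \<le> t * real N / T" "t * real N / T < real (step_index T N t) + 1"
    by linarith+
  then show "real (step_index T N t) * T / real N \<le> t" "t < (real (step_index T N t) + 1) * T / real N"
    using assms by (auto simp: field_simps)
qed

lemma step_index_end: "T > 0 \<Longrightarrow> N \<ge> 1 \<Longrightarrow> step_index T N T = N"
  by (rule step_index_eqI) (auto simp: field_simps)

lemma step_index_less_Suc:
  assumes "T > 0" "N \<ge> 1" "t \<in> {0..T}"
  shows "step_index T N t < Suc N"
proof -
  have "real (step_index T N t) * T / real N \<le> T"
    using step_index_bounds(1)[OF assms(1,2), of t] assms(3) by auto
  then have "real (step_index T N t) \<le> real N" using assms by (simp add: field_simps)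
  then show ?thesis by simp
qed

lemma step_path_cadlag:
  assumes T: "T > 0" and N: "N \<ge> 1"
  shows "step_path T N v \<in> cadlag_paths T"
proof -
  have "(step_path T N v \<longlongrightarrow> step_path T N v t) (at_right t)" if t: "t \<in> {0..<T}" for t
  proof (rule tendsto_eventually)
    let ?k = "step_index T N t"
    note b = step_index_bounds[OF T N, of t]
    have "step_path T N v s = step_path T N v t"
      if "t < s" "s < min T ((real ?k + 1) * T / real N)" for s
    proof -
      have "step_index T N s = ?k" using that b t by (intro step_index_eqI[OF T N]) auto
      then show ?thesis using that t by (simp add: step_path_def)
    qed
    then show "\<forall>\<^sub>F s in at_right t. step_path T N v s = step_path T N v t"
      unfolding eventually_at_right_field
      using b t by (intro exI[of _ "min T ((real ?k + 1) * T / real N)"]) auto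
  qed
  moreover have "\<exists>l. (step_path T N v \<longlongrightarrow> l) (at_left t)" if t: "t \<in> {0<..T}" for t
  proof -
    define k where "k = nat (\<lceil>t * real N / T\<rceil> - 1)"
    have "\<lceil>t * real N / T\<rceil> \<ge> 1" using t T N by simp
    then have "real k = of_int \<lceil>t * real N / T\<rceil> - 1" by (simp add: k_def)
    then have "real k < t * real N / T" "t * real N / T \<le> real k + 1" by linarith+
    then have k: "real k * T / real N < t" "t \<le> (real k + 1) * T / real N"
      using T N by (auto simp: field_simps)
    have "step_path T N v s = v k" if "real k * T / real N < s" "s < t" for s
    proof -
      have "step_index T N s = k" using that k by (intro step_index_eqI[OF T N]) auto
      moreover have "0 \<le> s" using that T by (smt (verit) divide_nonneg_nonneg mult_nonneg_nonneg of_nat_0_le_iff)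
      ultimately show ?thesis using that t by (simp add: step_path_def)
    qed
    then have "\<forall>\<^sub>F s in at_left t. step_path T N v s = v k"
      unfolding eventually_at_left_field using k by (intro exI[of _ "real k * T / real N"]) auto
    then show ?thesis using tendsto_eventually by blast
  qed
  ultimately show ?thesis by (auto simp: cadlag_paths_def step_path_def)
qed

lemma step_path_constant_on:
  assumes T: "T > 0" and N: "N \<ge> 1" and k: "k < N"
  shows "step_path T N v constant_on {real k * T / real N ..< (real k + 1) * T / real N}"
proof -
  have "step_path T N v s = v k" if s: "s \<in> {real k * T / real N ..< (real k + 1) * T / real N}" for s
  proof -
    have "0 \<le> real k * T / real N" using T by simp
    moreover have "(real k + 1) * T / real N \<le> T"
    proof -
      have "(real k + 1) * T \<le> real N * T" using k T by (intro mult_right_mono) auto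
      then show ?thesis using N by (simp add: divide_le_eq mult.commute)
    qed
    ultimately have "s \<in> {0..T}" using s by auto
    then show ?thesis using step_index_eqI[OF T N, of k s] s by (simp add: step_path_def)
  qed
  then show ?thesis by (auto simp: constant_on_def)
qed

text \<open>Without any time change, two step paths on the same grid are as close as their values.\<close>

lemma continuous_map_step_path:
  assumes T: "T > 0" and N: "N \<ge> 1"
  shows "continuous_map (Euclidean_space (Suc N)) (skorokhod T) (step_path T N)"
proof -
  interpret Metric_space "cadlag_paths T" "skorokhod_dist T"
    by (rule Metric_space_skorokhod) (use T in simp)
  show ?thesis
    unfolding skorokhod_def continuous_map_to_metric
  proof (intro ballI allI impI)
    fix v and e :: real assume v: "v \<in> topspace (Euclidean_space (Suc N))" and e: "e > 0"
    define V where "V = {w :: nat \<Rightarrow> real. \<forall>i\<in>{..N}. w i \<in> {v i - e/2<..<v i + e/2}}"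
    have "open V"
      unfolding V_def by (rule product_topology_basis'[of "{..N}" "\<lambda>i. {v i - e/2<..<v i + e/2}" "\<lambda>i. i"]) auto
    moreover have "step_path T N w \<in> mball (step_path T N v) e" if w: "w \<in> V" for w
    proof -
      have "skorokhod_dist T (step_path T N v) (step_path T N w) \<le> e/2"
      proof (rule skorokhod_dist_le[OF _ time_changes_id])
        fix t assume t: "t \<in> {0..T}"
        have "step_index T N t \<in> {..N}" using step_index_less_Suc[OF T N t] by simp
        then have "w (step_index T N t) \<in> {v (step_index T N t) - e/2<..<v (step_index T N t) + e/2}"
          using w unfolding V_def by blast
        then have "\<bar>v (step_index T N t) - w (step_index T N t)\<bar> \<le> e/2"
          unfolding greaterThanLessThan_iff by linarith
        then show "\<bar>step_path T N v t - step_path T N w t\<bar> \<le> e/2"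
          using t by (simp add: step_path_def)
      qed (use T e in auto)
      then show ?thesis using e step_path_cadlag[OF T N] by simp
    qed
    moreover have "v \<in> V" using e by (auto simp: V_def)
    ultimately show "\<exists>U. openin (Euclidean_space (Suc N)) U \<and> v \<in> U \<and>
        (\<forall>w\<in>U. step_path T N w \<in> mball (step_path T N v) e)"
      using v by (intro exI[of _ "V \<inter> topspace (Euclidean_space (Suc N))"])
        (auto simp: openin_Euclidean_space)
  qed
qed

lemma measurable_grid_values:
  assumes T: "T > 0" and N: "N \<ge> 1"
  shows "grid_values T N \<in> borel_of (skorokhod T) \<rightarrow>\<^sub>M borel_of (Euclidean_space (Suc N))"
proof (rule measurable_Euclidean_spaceI)
  fix i assume i: "i < Suc N"
  then have "real i * T / real N \<in> {0..T}" using T N by (auto simp: field_simps)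
  then show "(\<lambda>x. grid_values T N x i) \<in> borel_measurable (borel_of (skorokhod T))"
    using coordinate_borel_measurable[of T] T i by (simp add: grid_values_def)
qed (simp add: grid_values_def)

lemma step_path_grid_values:
  assumes "T > 0" "N \<ge> 1" "t \<in> {0..T}"
  shows "step_path T N (grid_values T N x) t = x (real (step_index T N t) * T / real N)"
  using assms step_index_less_Suc[OF assms] by (simp add: step_path_def grid_values_def)

section \<open>Discretization of cadlag paths\<close>

text \<open>A grid point is below \<open>b\<close> iff it is below the rounded-up point \<open>grid_ceiling T N b\<close>. So if \<open>t\<close>
  lies between the rounded-up points of \<open>a\<close> and \<open>b\<close>, then the grid point at which the step path
  reads its value at time \<open>t\<close> lies in \<open>[a, b)\<close>, where \<open>x\<close> may be assumed to oscillate little. A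
  time change that sends the rounded-up points back to the original ones thus makes the
  discretized path close to \<open>x\<close>.\<close>

definition grid_ceiling :: "real \<Rightarrow> nat \<Rightarrow> real \<Rightarrow> real" where
  "grid_ceiling T N b = of_int \<lceil>b * real N / T\<rceil> * T / real N"

lemma grid_ceiling_bounds:
  assumes "T > 0" "N \<ge> 1"
  shows "b \<le> grid_ceiling T N b" "grid_ceiling T N b < b + T / real N"
proof -
  define c :: real where "c = of_int \<lceil>b * real N / T\<rceil>"
  have "b * real N / T \<le> c" "c < b * real N / T + 1"
    unfolding c_def by linarith+
  then show "b \<le> grid_ceiling T N b" "grid_ceiling T N b < b + T / real N"
    unfolding grid_ceiling_def c_def[symmetric] using assms by (auto simp: field_simps)
qed

lemma grid_point_less_grid_ceiling:
  assumes "T > 0" "N \<ge> 1" "real k * T / real N < grid_ceiling T N b"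
  shows "real k * T / real N < b"
proof -
  have "real k < of_int \<lceil>b * real N / T\<rceil>"
    using assms by (simp add: grid_ceiling_def field_simps)
  then have "int k < \<lceil>b * real N / T\<rceil>" by linarith
  then have "real k < b * real N / T" by (simp add: less_ceiling_iff)
  then show ?thesis using assms by (simp add: field_simps)
qed

lemma grid_ceiling_le_grid_point:
  assumes T: "T > 0" and N: "N \<ge> 1" and "t \<ge> 0" "grid_ceiling T N a \<le> t"
  shows "grid_ceiling T N a \<le> real (step_index T N t) * T / real N"
proof -
  have "grid_ceiling T N a < (real (step_index T N t) + 1) * T / real N"
    using step_index_bounds(2)[OF T N] assms by (smt (verit))
  then have "of_int \<lceil>a * real N / T\<rceil> < real (step_index T N t) + 1"
    using T N by (simp add: grid_ceiling_def divide_less_cancel)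
  then have "\<lceil>a * real N / T\<rceil> \<le> int (step_index T N t)" by linarith
  then have "of_int \<lceil>a * real N / T\<rceil> \<le> real (step_index T N t)" by linarith
  then show ?thesis using T N by (simp add: grid_ceiling_def divide_le_cancel)
qed

lemma grid_ceiling_0: "grid_ceiling T N 0 = 0"
  by (simp add: grid_ceiling_def)

lemma grid_ceiling_end: "T > 0 \<Longrightarrow> N \<ge> 1 \<Longrightarrow> grid_ceiling T N T = T"
  by (simp add: grid_ceiling_def)

text \<open>The time change for the part of the path before \<open>b\<close>: it lives on the times up to the
  rounded-up point of \<open>b\<close> and ends in \<open>b\<close>. Along it \<open>x\<close> is close to the discretized path
  strictly before the endpoint; at the endpoint \<open>x\<close> may jump.\<close>

definition grid_matching ::
  "real \<Rightarrow> (real \<Rightarrow> real) \<Rightarrow> real \<Rightarrow> nat \<Rightarrow> real \<Rightarrow> (real \<Rightarrow> real) \<Rightarrow> bool" where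
  "grid_matching T x e N b \<theta> \<longleftrightarrow>
     strict_mono_on {0..grid_ceiling T N b} \<theta> \<and> continuous_on {0..grid_ceiling T N b} \<theta> \<and>
     \<theta> 0 = 0 \<and> \<theta> (grid_ceiling T N b) = b \<and>
     (\<forall>t\<in>{0..grid_ceiling T N b}. \<bar>\<theta> t - t\<bar> \<le> T / real N) \<and>
     (\<forall>t\<in>{0..<grid_ceiling T N b}. \<bar>x (real (step_index T N t) * T / real N) - x (\<theta> t)\<bar> \<le> e)"

text \<open>The time change is continued linearly from the rounded-up point of \<open>a\<close> to that of \<open>b\<close>. Its
  displacement is then a convex combination of the two rounding errors, each at most one step
  length. The condition on \<open>b - a\<close> makes the two rounded-up points distinct.\<close>

lemma grid_matching_extend:
  assumes T: "T > 0" and N: "N \<ge> 1" and ab: "0 \<le> a" "a < b" "T / real N < b - a"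
    and osc: "\<And>s t. s \<in> {a..<b} \<Longrightarrow> t \<in> {a..<b} \<Longrightarrow> \<bar>x s - x t\<bar> \<le> e"
    and \<theta>: "grid_matching T x e N a \<theta>"
  shows "\<exists>\<theta>'. grid_matching T x e N b \<theta>'"
proof -
  define u v where "u = grid_ceiling T N a" and "v = grid_ceiling T N b"
  define l where "l t = a + (b - a) * ((t - u) / (v - u))" for t
  define \<theta>' where "\<theta>' t = (if t \<le> u then \<theta> t else l t)" for t
  have u: "a \<le> u" "u < a + T / real N" and v: "b \<le> v" "v < b + T / real N"
    using grid_ceiling_bounds[OF T N] by (auto simp: u_def v_def)
  have uv: "0 \<le> u" "u < v" using u v ab by auto
  have mono: "\<theta> s < \<theta> t" if "0 \<le> s" "s < t" "t \<le> u" for s t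
    using \<theta> that by (auto simp: grid_matching_def u_def strict_mono_on_def)
  have cont: "continuous_on {0..u} \<theta>" and \<theta>0: "\<theta> 0 = 0" and \<theta>u: "\<theta> u = a"
    and disp: "\<And>t. t \<in> {0..u} \<Longrightarrow> \<bar>\<theta> t - t\<bar> \<le> T / real N"
    and close: "\<And>t. t \<in> {0..<u} \<Longrightarrow> \<bar>x (real (step_index T N t) * T / real N) - x (\<theta> t)\<bar> \<le> e"
    using \<theta> by (auto simp: grid_matching_def u_def)
  have lu: "l u = a" and lv: "l v = b" using uv by (auto simp: l_def)
  have lmono: "l s < l t" if "s < t" for s t
    using that uv ab by (auto simp: l_def divide_strict_right_mono)
  have mono': "\<theta>' s < \<theta>' t" if st: "0 \<le> s" "s < t" "t \<le> v" for s t
  proof -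
    consider "t \<le> u" | "s \<le> u" "u < t" | "u < s" by linarith
    then show ?thesis
    proof cases
      case 2
      have "\<theta> s \<le> a" using mono[of s u] \<theta>u st 2 by (cases "s = u") auto
      also have "a < l t" using lmono[of u t] 2 lu by simp
      finally show ?thesis using 2 by (simp add: \<theta>'_def)
    qed (use st mono lmono in \<open>auto simp: \<theta>'_def\<close>)
  qed
  have cont': "continuous_on {0..v} \<theta>'"
  proof -
    have "continuous_on ({0..u} \<union> {u..v}) (\<lambda>t. if t \<le> u then \<theta> t else l t)"
      by (rule continuous_on_cases) (use cont \<theta>u lu uv in \<open>auto simp: l_def intro!: continuous_intros\<close>)
    moreover have "{0..u} \<union> {u..v} = {0..v}" using uv by auto
    ultimately show ?thesis by (simp add: \<theta>'_def[abs_def])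
  qed
  have disp': "\<bar>\<theta>' t - t\<bar> \<le> T / real N" if t: "t \<in> {0..v}" for t
  proof (cases "t \<le> u")
    case True then show ?thesis using disp t by (simp add: \<theta>'_def)
  next
    case False
    define p where "p = (t - u) / (v - u)"
    have p: "0 \<le> p" "p \<le> 1" using False t uv by (auto simp: p_def)
    have tp: "t = u + (v - u) * p" using uv by (simp add: p_def)
    have "l t - t = - ((1 - p) * (u - a) + p * (v - b))"
      unfolding l_def p_def[symmetric] by (subst tp) (simp add: algebra_simps)
    moreover have "(1 - p) * (u - a) + p * (v - b) \<le> T / real N"
      by (rule convex_bound_le) (use p u v in auto)
    moreover have "0 \<le> (1 - p) * (u - a) + p * (v - b)" using p u v by simp
    ultimately show ?thesis using False by (simp add: \<theta>'_def)
  qed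
  have close': "\<bar>x (real (step_index T N t) * T / real N) - x (\<theta>' t)\<bar> \<le> e" if t: "t \<in> {0..<v}" for t
  proof (cases "t < u")
    case True then show ?thesis using close t by (simp add: \<theta>'_def)
  next
    case False
    have "\<theta>' t = l t" using False lu \<theta>u by (auto simp: \<theta>'_def)
    moreover have "a \<le> l t" using lmono[of u t] lu False by (cases "t = u") auto
    moreover have "l t < b" using lmono[of t v] lv t by simp
    moreover have "a \<le> real (step_index T N t) * T / real N"
      using grid_ceiling_le_grid_point[OF T N, of t a] t False u by (simp add: u_def)
    moreover have "real (step_index T N t) * T / real N < b"
      using grid_point_less_grid_ceiling[OF T N, of "step_index T N t" b] step_index_bounds(1)[OF T N, of t] t
      by (simp add: v_def)
    ultimately show ?thesis using osc by simp
  qed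
  have "\<theta>' 0 = 0" using uv \<theta>0 by (simp add: \<theta>'_def)
  moreover have "\<theta>' v = b" using uv lv by (simp add: \<theta>'_def)
  ultimately have "grid_matching T x e N b \<theta>'"
    unfolding grid_matching_def v_def[symmetric]
    using mono' cont' disp' close' by (auto simp: strict_mono_on_def)
  then show ?thesis by blast
qed

lemma eventually_grid_matching_extend:
  assumes T: "T > 0" and ab: "0 \<le> a" "a \<le> b"
    and osc: "\<And>s t. s \<in> {a..<b} \<Longrightarrow> t \<in> {a..<b} \<Longrightarrow> \<bar>x s - x t\<bar> \<le> e"
    and ev: "\<forall>\<^sub>F N in sequentially. \<exists>\<theta>. grid_matching T x e N a \<theta>"
  shows "\<forall>\<^sub>F N in sequentially. \<exists>\<theta>. grid_matching T x e N b \<theta>"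
proof (cases "a = b")
  case False
  then have "b - a > 0" using ab by simp
  then have "\<forall>\<^sub>F N in sequentially. T / real N < b - a"
    using order_tendstoD(2)[OF lim_const_over_n[of T]] by simp
  with ev eventually_ge_at_top[of 1] show ?thesis
    by eventually_elim (use grid_matching_extend[OF T] ab osc False in auto)
qed (use ev in simp)

text \<open>Near each time \<open>s\<close> the path oscillates by at most \<open>e\<close> on an interval ending just before \<open>s\<close>
  and on one starting at \<open>s\<close>, by the one-sided limits. So a matching up to \<open>a\<close> extends first
  to \<open>s\<close> and then to \<open>b\<close> whenever \<open>a \<le> s \<le> b\<close> are close, and \<open>Bolzano\<close> carries this
  from \<open>0\<close> to \<open>T\<close>. Only finitely many extensions are made, so \<open>N\<close> can be taken large for all
  of them at once; this is why the statement propagated is the one for all large \<open>N\<close>.\<close>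

lemma eventually_grid_matching:
  assumes T: "T > 0" and x: "x \<in> cadlag_paths T" and e: "e > 0"
  shows "\<forall>\<^sub>F N in sequentially. \<exists>\<theta>. grid_matching T x e N T \<theta>"
proof -
  define Q where "Q b \<longleftrightarrow> (\<forall>\<^sub>F N in sequentially. \<exists>\<theta>. grid_matching T x e N b \<theta>)" for b
  have "0 \<le> (0::real) \<and> T \<le> T \<and> Q 0 \<longrightarrow> Q T"
  proof (rule Bolzano[where P = "\<lambda>a b. 0 \<le> a \<and> b \<le> T \<and> Q a \<longrightarrow> Q b"])
    show "0 \<le> T" using T by simp
  next
    fix s assume s: "0 \<le> s" "s \<le> T"
    have "\<exists>d>0. \<forall>p q. p \<in> {s..<s+d} \<and> q \<in> {s..<s+d} \<and> p < T \<and> q < T \<longrightarrow> \<bar>x p - x q\<bar> \<le> e"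
    proof (cases "s < T")
      case True
      obtain d where d: "d > 0" "\<And>p. s \<le> p \<Longrightarrow> p < s + d \<Longrightarrow> \<bar>x p - x s\<bar> < e/2"
        using cadlag_right_near[OF x s(1) True, of "e/2"] e by auto
      have "\<bar>x p - x q\<bar> \<le> e" if "p \<in> {s..<s+d}" "q \<in> {s..<s+d}" for p q
        using d(2)[of p] d(2)[of q] that unfolding atLeastLessThan_iff by linarith
      then show ?thesis using d by blast
    qed (auto intro!: exI[of _ 1])
    then obtain d1 where d1: "d1 > 0"
      "\<And>p q. p \<in> {s..<s+d1} \<Longrightarrow> q \<in> {s..<s+d1} \<Longrightarrow> p < T \<Longrightarrow> q < T \<Longrightarrow> \<bar>x p - x q\<bar> \<le> e" by blast
    have "\<exists>d>0. \<forall>p q. p \<in> {s-d<..<s} \<and> q \<in> {s-d<..<s} \<and> 0 \<le> p \<and> 0 \<le> q \<longrightarrow> \<bar>x p - x q\<bar> \<le> e"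
    proof (cases "0 < s")
      case True
      obtain d l where d: "d > 0" "\<And>p. s - d < p \<Longrightarrow> p < s \<Longrightarrow> \<bar>x p - l\<bar> < e/2"
        using cadlag_left_near[OF x True s(2), of "e/2"] e by (metis half_gt_zero)
      have "\<bar>x p - x q\<bar> \<le> e" if "p \<in> {s-d<..<s}" "q \<in> {s-d<..<s}" for p q
        using d(2)[of p] d(2)[of q] that unfolding greaterThanLessThan_iff by linarith
      then show ?thesis using d(1) by blast
    qed (use s in \<open>auto intro!: exI[of _ 1]\<close>)
    then obtain d2 where d2: "d2 > 0"
      "\<And>p q. p \<in> {s-d2<..<s} \<Longrightarrow> q \<in> {s-d2<..<s} \<Longrightarrow> 0 \<le> p \<Longrightarrow> 0 \<le> q \<Longrightarrow> \<bar>x p - x q\<bar> \<le> e" by blast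
    show "\<exists>d>0. \<forall>a b. a \<le> s \<and> s \<le> b \<and> b - a < d \<longrightarrow> (0 \<le> a \<and> b \<le> T \<and> Q a \<longrightarrow> Q b)"
    proof (intro exI[of _ "min d1 d2"] conjI allI impI)
      fix a b assume ab: "a \<le> s \<and> s \<le> b \<and> b - a < min d1 d2" and Q: "0 \<le> a \<and> b \<le> T \<and> Q a"
      have "Q s" unfolding Q_def
        by (rule eventually_grid_matching_extend[OF T, where a = a])
          (use ab Q d2 in \<open>auto simp: Q_def\<close>)
      then show "Q b" unfolding Q_def
        by (rule eventually_grid_matching_extend[OF T, where a = s, rotated 3])
          (use ab Q d1 s in auto)
    qed (use d1 d2 in auto)
  qed auto
  moreover have "Q 0"
    unfolding Q_def
  proof (rule eventually_mono[OF eventually_ge_at_top[of 1]])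
    fix N :: nat assume "1 \<le> N"
    then have "grid_matching T x e N 0 (\<lambda>t. t)"
      using T by (auto simp: grid_matching_def grid_ceiling_0 strict_mono_on_def)
    then show "\<exists>\<theta>. grid_matching T x e N 0 \<theta>" by blast
  qed
  ultimately show ?thesis by (simp add: Q_def)
qed

lemma limitin_step_path_grid_values:
  assumes T: "T > 0" and x: "x \<in> cadlag_paths T"
  shows "limitin (skorokhod T) (\<lambda>n. step_path T (Suc n) (grid_values T (Suc n) x)) x sequentially"
proof -
  interpret Metric_space "cadlag_paths T" "skorokhod_dist T"
    by (rule Metric_space_skorokhod) (use T in simp)
  have "\<forall>\<^sub>F N in sequentially. skorokhod_dist T (step_path T N (grid_values T N x)) x < e"
    if e: "e > 0" for e
  proof -
    have "\<forall>\<^sub>F N in sequentially. T / real N < e/2"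
      using order_tendstoD(2)[OF lim_const_over_n[of T], of "e/2"] e by simp
    with eventually_grid_matching[OF T x, of "e/2"] e eventually_ge_at_top[of 1]
    have "\<forall>\<^sub>F N in sequentially. (\<exists>\<theta>. grid_matching T x (e/2) N T \<theta>) \<and> 1 \<le> N \<and> T / real N < e/2"
      by (simp add: eventually_conj)
    then show ?thesis
    proof (rule eventually_mono)
      fix N assume *: "(\<exists>\<theta>. grid_matching T x (e/2) N T \<theta>) \<and> 1 \<le> N \<and> T / real N < e/2"
      then have N: "N \<ge> 1" and TN: "T / real N < e/2" by auto
      obtain \<theta> where "grid_matching T x (e/2) N T \<theta>" using * by blast
      then have mono: "strict_mono_on {0..T} \<theta>" and cont: "continuous_on {0..T} \<theta>"
        and ends: "\<theta> 0 = 0" "\<theta> T = T"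
        and disp: "\<And>t. t \<in> {0..T} \<Longrightarrow> \<bar>\<theta> t - t\<bar> \<le> T / real N"
        and close: "\<And>t. t \<in> {0..<T} \<Longrightarrow> \<bar>x (real (step_index T N t) * T / real N) - x (\<theta> t)\<bar> \<le> e/2"
        unfolding grid_matching_def grid_ceiling_end[OF T N] by auto
      have "\<theta> ` {0..T} = {0..T}"
      proof
        show "\<theta> ` {0..T} \<subseteq> {0..T}"
          using strict_mono_on_leD[OF mono, of 0] strict_mono_on_leD[OF mono, of _ T] ends T by auto
        show "{0..T} \<subseteq> \<theta> ` {0..T}"
          using IVT'[of \<theta> 0 _ T] ends cont T by (force simp: image_iff)
      qed
      then have \<theta>: "\<theta> \<in> time_changes T" using mono cont by (simp add: time_changes_def)
      have "skorokhod_dist T (step_path T N (grid_values T N x)) x \<le> e/2"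
      proof (rule skorokhod_dist_le[OF _ \<theta>])
        fix t assume t: "t \<in> {0..T}"
        show "\<bar>\<theta> t - t\<bar> \<le> e/2" using disp[OF t] TN by linarith
        show "\<bar>step_path T N (grid_values T N x) t - x (\<theta> t)\<bar> \<le> e/2"
        proof (cases "t = T")
          case True
          then show ?thesis
            using T N e ends by (simp add: step_path_grid_values step_index_end)
        next
          case False
          then show ?thesis
            using close[of t] t by (simp add: step_path_grid_values[OF T N t])
        qed
      qed (use T in simp)
      then show "skorokhod_dist T (step_path T N (grid_values T N x)) x < e" using e by simp
    qed
  qed
  then have "\<forall>\<^sub>F n in sequentially. skorokhod_dist T (step_path T (Suc n) (grid_values T (Suc n) x)) x < e"
    if "e > 0" for e
    using that by (subst eventually_sequentially_Suc)
  then show ?thesis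
    unfolding skorokhod_def limitin_metric using x step_path_cadlag[OF T] by simp
qed

section \<open>Step processes with prescribed step values\<close>

text \<open>The law of the step path with values distributed as \<open>\<rho>\<close>, on the set of step paths rather than on
  the whole Skorokhod space: the paths of the coordinate process have to be stepwise
  at every sample point, not only almost surely.\<close>

definition step_process_measure :: "real \<Rightarrow> nat \<Rightarrow> (nat \<Rightarrow> real) measure \<Rightarrow> (real \<Rightarrow> real) measure" where
  "step_process_measure T N \<rho> =
     distr \<rho> (restrict_space (borel_of (skorokhod T)) (range (step_path T N))) (step_path T N)"

text \<open>The coordinate process on the step paths. Its values at times \<open>t i\<close> are the coordinates with
  indices \<open>step_index T N (t i)\<close> of a vector with law \<open>\<rho>\<close>, which is the form of
  law that coordinate stability speaks about.\<close>

lemma step_process: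
  assumes T: "T > 0" and N: "N \<ge> 1" and \<rho>: "\<rho> \<in> prob_measures (Euclidean_space (Suc N))"
  defines "M \<equiv> step_process_measure T N \<rho>" and "X \<equiv> \<lambda>t \<omega>. \<omega> t"
  shows "cadlag_process T M X" and "equal_step_paths T M X"
    and "process_law T M X = distr \<rho> (borel_of (skorokhod T)) (step_path T N)"
    and "(\<And>i. i < k \<Longrightarrow> t i \<in> {0..T}) \<Longrightarrow> fin_dim_law M X k t =
      distr \<rho> (borel_of (Euclidean_space k)) (\<lambda>v i. if i < k then v (step_index T N (t i)) else 0)"
proof -
  let ?B = "borel_of (skorokhod T)"
  let ?R = "restrict_space ?B (range (step_path T N))"
  have step: "step_path T N \<in> \<rho> \<rightarrow>\<^sub>M ?B"
    using continuous_map_measurable_borel_of[OF continuous_map_step_path[OF T N]] \<rho>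
    by (simp add: prob_measures_measurable_cong)
  then have stepR: "step_path T N \<in> \<rho> \<rightarrow>\<^sub>M ?R"
    by (intro measurable_restrict_space2) auto
  have spB: "space ?B = cadlag_paths T"
    using T by (simp add: space_borel_of topspace_skorokhod)
  have M: "M = distr \<rho> ?R (step_path T N)"
    by (simp add: M_def step_process_measure_def)
  have spM: "space M = range (step_path T N)"
    using step_path_cadlag[OF T N] by (auto simp: M space_restrict_space spB)
  have coord: "(\<lambda>\<omega>. \<omega> s) \<in> borel_measurable M" if "s \<in> {0..T}" for s
    using coordinate_borel_measurable[OF _ that] T
    by (auto simp: M intro: measurable_restrict_space1)
  have path: "path T X \<omega> = \<omega>" if "\<omega> \<in> range (step_path T N)" for \<omega>
    using that by (auto simp: path_def X_def step_path_def)
  have pathM: "path T X \<in> M \<rightarrow>\<^sub>M ?B"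
  proof -
    have "(\<lambda>\<omega>. \<omega>) \<in> M \<rightarrow>\<^sub>M ?B"
      by (simp add: M measurable_restrict_space1)
    then show ?thesis
      by (subst measurable_cong[of M _ "\<lambda>\<omega>. \<omega>"]) (simp_all add: spM path)
  qed
  have "prob_space \<rho>" using \<rho> by (simp add: prob_measures_def)
  then have "prob_space M"
    unfolding M by (rule prob_space.prob_space_distr[OF _ stepR])
  then show "cadlag_process T M X"
    using coord pathM by (simp add: cadlag_process_def X_def)
  show "equal_step_paths T M X"
    unfolding equal_step_paths_def spM X_def
    using N step_path_constant_on[OF T N] by (intro exI[of _ N]) auto
  have "distr M ?B (path T X) = distr \<rho> ?B (path T X \<circ> step_path T N)"
    unfolding M by (rule distr_distr) (use pathM stepR in \<open>simp_all add: M\<close>)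
  also have "path T X \<circ> step_path T N = step_path T N"
    by (simp add: fun_eq_iff[of _ "step_path T N"] path[OF rangeI])
  finally show "process_law T M X = distr \<rho> ?B (step_path T N)"
    by (simp add: process_law_def)
  assume t: "\<And>i. i < k \<Longrightarrow> t i \<in> {0..T}"
  let ?g = "\<lambda>\<omega> i. if i < k then X (t i) \<omega> else 0"
  have g: "?g \<in> M \<rightarrow>\<^sub>M borel_of (Euclidean_space k)"
    by (rule measurable_Euclidean_spaceI) (use t coord in \<open>auto simp: X_def\<close>)
  have "fin_dim_law M X k t = distr \<rho> (borel_of (Euclidean_space k)) (?g \<circ> step_path T N)"
    unfolding fin_dim_law_def unfolding M
    by (rule distr_distr) (use g stepR in \<open>simp_all add: M\<close>)
  also have "?g \<circ> step_path T N = (\<lambda>v i. if i < k then v (step_index T N (t i)) else 0)"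
    using t by (auto simp: fun_eq_iff X_def step_path_def)
  finally show "fin_dim_law M X k t =
      distr \<rho> (borel_of (Euclidean_space k)) (\<lambda>v i. if i < k then v (step_index T N (t i)) else 0)" .
qed

section \<open>Density of step processes\<close>

theorem theorem3p6:
  fixes \<Phi> :: "nat \<Rightarrow> (nat \<Rightarrow> real) measure set" and T :: real
  assumes "\<And>d. d \<ge> 1 \<Longrightarrow> \<Phi> d \<subseteq> prob_measures (Euclidean_space d)"
    and "\<And>d. d \<ge> 1 \<Longrightarrow> weak_topology (Euclidean_space d) closure_of \<Phi> d = prob_measures (Euclidean_space d)"
    and "coordinate_stable \<Phi>"
    and "T > 0"
  shows "weak_topology (skorokhod T) closure_of
           {process_law T M X | (M :: (real \<Rightarrow> real) measure) X.
              cadlag_process T M X \<and> is_Phi_process \<Phi> T M X \<and> equal_step_paths T M X}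
         = prob_measures (skorokhod T)"
    (is "?W closure_of ?C = _")
proof
  let ?B = "borel_of (skorokhod T)"
  note T = \<open>T > 0\<close>
  show "?W closure_of ?C \<subseteq> prob_measures (skorokhod T)"
    using closure_of_subset_topspace[of ?W ?C] by (simp add: topspace_weak_topology)
  have C: "distr \<rho> ?B (step_path T N) \<in> ?C" if N: "N \<ge> 1" and \<rho>: "\<rho> \<in> \<Phi> (Suc N)" for N \<rho>
  proof -
    have \<rho>': "\<rho> \<in> prob_measures (Euclidean_space (Suc N))" using assms(1)[of "Suc N"] \<rho> by auto
    note step = step_process[OF T N \<rho>']
    have "is_Phi_process \<Phi> T (step_process_measure T N \<rho>) (\<lambda>t \<omega>. \<omega> t)"
      unfolding is_Phi_process_def
    proof (intro allI impI)
      fix k :: nat and t :: "nat \<Rightarrow> real" assume k: "1 \<le> k" and t: "\<forall>i<k. t i \<in> {0..T}"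
      have "distr \<rho> (borel_of (Euclidean_space k)) (\<lambda>v i. if i < k then v (step_index T N (t i)) else 0) \<in> \<Phi> k"
        using assms(3)[unfolded coordinate_stable_def, rule_format, of "Suc N" k "\<lambda>i. step_index T N (t i)" \<rho>]
          k t \<rho> step_index_less_Suc[OF T N] by simp
      then show "fin_dim_law (step_process_measure T N \<rho>) (\<lambda>t \<omega>. \<omega> t) k t \<in> \<Phi> k"
        using step(4)[of k t] t by simp
    qed
    with step(1-3) show ?thesis by (smt (verit) mem_Collect_eq)
  qed
  show "prob_measures (skorokhod T) \<subseteq> ?W closure_of ?C"
  proof
    fix \<mu> assume \<mu>: "\<mu> \<in> prob_measures (skorokhod T)"
    let ?step = "\<lambda>n. step_path T (Suc n)" and ?grid = "\<lambda>n. grid_values T (Suc n)"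
    let ?E = "\<lambda>n. Euclidean_space (Suc (Suc n))"
    have step: "continuous_map (?E n) (skorokhod T) (?step n)" for n
      by (rule continuous_map_step_path[OF T]) simp
    have grid: "?grid n \<in> ?B \<rightarrow>\<^sub>M borel_of (?E n)" for n
      by (rule measurable_grid_values[OF T]) simp
    have stepm: "?step n \<in> borel_of (?E n) \<rightarrow>\<^sub>M ?B" for n
      by (rule continuous_map_measurable_borel_of[OF step])
    have grid\<mu>: "?grid n \<in> \<mu> \<rightarrow>\<^sub>M borel_of (?E n)" for n
      using grid \<mu> by (simp add: prob_measures_measurable_cong)
    let ?\<mu> = "\<lambda>n. distr \<mu> ?B (\<lambda>x. ?step n (?grid n x))"
    have "?\<mu> n \<in> ?W closure_of ?C" for n
    proof -
      let ?h = "\<lambda>\<rho>. distr \<rho> ?B (?step n)"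
      have "distr \<mu> (borel_of (?E n)) (?grid n) \<in> prob_measures (?E n)"
        using distr_in_prob_measures[OF _ grid\<mu>] \<mu> by (simp add: prob_measures_def)
      also have "prob_measures (?E n) = weak_topology (?E n) closure_of \<Phi> (Suc (Suc n))"
        using assms(2)[of "Suc (Suc n)"] by simp
      finally have "?h (distr \<mu> (borel_of (?E n)) (?grid n)) \<in> ?W closure_of (?h ` \<Phi> (Suc (Suc n)))"
        using continuous_map_image_closure_subset[OF continuous_map_weak_topology_distr[OF step]] by blast
      also have "?h (distr \<mu> (borel_of (?E n)) (?grid n)) = ?\<mu> n"
        by (subst distr_distr[OF stepm grid\<mu>]) (simp add: o_def)
      finally have "?\<mu> n \<in> ?W closure_of (?h ` \<Phi> (Suc (Suc n)))" .
      moreover have "?h ` \<Phi> (Suc (Suc n)) \<subseteq> ?C"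
        by (rule image_subsetI, rule C) auto
      ultimately show ?thesis
        using closure_of_mono[of _ ?C ?W] by (meson subsetD)
    qed
    moreover have "limitin ?W ?\<mu> \<mu> sequentially"
    proof (rule limitin_weak_topology_distr_pointwise[OF \<mu>])
      show "(\<lambda>x. ?step n (?grid n x)) \<in> ?B \<rightarrow>\<^sub>M ?B" for n
        using measurable_compose[OF grid stepm] .
      show "limitin (skorokhod T) (\<lambda>n. ?step n (?grid n x)) x sequentially"
        if "x \<in> topspace (skorokhod T)" for x
        using limitin_step_path_grid_values[OF T] that T by (simp add: topspace_skorokhod)
    qed
    ultimately show "\<mu> \<in> ?W closure_of ?C"
      by (intro limitin_closedin[of ?W ?\<mu> \<mu> sequentially]) auto
  qed
qed

end
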